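(* No compactly finite-dimensional topological group contains a subspace homeomorphic to the Fréchet-Urysohn hedgehog $V_\omega$.
   Context: Topological groups are assumed Hausdorff. $\dim$ denotes the covering dimension. A topological group $G$ is called compactly finite-dimensional if $\sup\{\dim(K): K \text{ is a compact subspace of } G\}$ is finite. Let $H_\omega=\bigcup_{n\in\omega}[0,1]\cdot\vec e_n\subset l_2$, where $(\vec e_n)_{n\in\omega}$ is the standard orthonormal basis of the Hilbert space $l_2$ and $[0,1]\cdot\vec e_n=\{t\vec e_n: t\in[0,1]\}$. The Fréchet-Urysohn hedgehog $V_\omega$ is the set $H_\omega$ endowed with the strongest topology that induces the original Euclidean topology on each needle $[0,1]\cdot\vec e_n$, $n\in\omega$. *)

theory Defs
  imports "HOL-Analysis.Analysis"
begin

text \<open>Cech--Lebesgue covering dimension: every finite open cover has a finite open refinement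
  such that every point lies in at most \<open>n + 1\<close> of its members.
  With the lower bound \<open>-1 \<le> n\<close>, exactly the empty space has dimension \<open>-1\<close>.\<close>

definition covering_dim_le :: "'a topology \<Rightarrow> int \<Rightarrow> bool" where
  "covering_dim_le X n \<longleftrightarrow> -1 \<le> n \<and>
     (\<forall>\<U>. finite \<U> \<and> (\<forall>U\<in>\<U>. openin X U) \<and> \<Union>\<U> = topspace X \<longrightarrow>
        (\<exists>\<V>. finite \<V> \<and> (\<forall>V\<in>\<V>. openin X V) \<and> \<Union>\<V> = topspace X \<and>
             (\<forall>V\<in>\<V>. \<exists>U\<in>\<U>. V \<subseteq> U) \<and>
             (\<forall>x\<in>topspace X. int (card {V\<in>\<V>. x \<in> V}) \<le> n + 1)))"

text \<open>The infimum of the empty set is \<open>\<infinity>\<close>, the value for infinite-dimensional spaces.\<close>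

definition covering_dim :: "'a topology \<Rightarrow> ereal" where
  "covering_dim X = (INF n\<in>{n. covering_dim_le X n}. ereal (real_of_int n))"

definition compactly_finite_dimensional :: "'a topology \<Rightarrow> bool" where
  "compactly_finite_dimensional X \<longleftrightarrow>
     (SUP K\<in>{K. compactin X K}. covering_dim (subtopology X K)) < \<infinity>"

definition l2_space :: "(nat \<Rightarrow> real) set" where
  "l2_space = {x. (\<lambda>k. (x k)\<^sup>2) summable_on UNIV}"

definition l2_dist :: "(nat \<Rightarrow> real) \<Rightarrow> (nat \<Rightarrow> real) \<Rightarrow> real" where
  "l2_dist x y = sqrt (\<Sum>\<^sub>\<infinity>k. (x k - y k)\<^sup>2)"

definition l2_topology :: "(nat \<Rightarrow> real) topology" where
  "l2_topology = Metric_space.mtopology l2_space l2_dist"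

lemma l2_space_diff_summable:
  assumes "x \<in> l2_space" "y \<in> l2_space"
  shows "(\<lambda>k. (x k - y k)\<^sup>2) summable_on UNIV"
proof (rule summable_on_comparison_test)
  show "(\<lambda>k. 2 * (x k)\<^sup>2 + 2 * (y k)\<^sup>2) summable_on UNIV"
    using assms unfolding l2_space_def
    by (intro summable_on_add summable_on_cmult_right) auto
  show "(x k - y k)\<^sup>2 \<le> 2 * (x k)\<^sup>2 + 2 * (y k)\<^sup>2" for k
    using sum_squares_bound[of "x k" "- y k"] by (simp add: power2_diff)
qed auto

lemma L2_set_le_l2_dist:
  assumes "x \<in> l2_space" "y \<in> l2_space" "finite F"
  shows "L2_set (\<lambda>k. x k - y k) F \<le> l2_dist x y"
  unfolding L2_set_def l2_dist_def
  by (intro real_sqrt_le_mono finite_sum_le_infsum l2_space_diff_summable assms) auto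

lemma l2_dist_nonneg: "0 \<le> l2_dist x y"
  unfolding l2_dist_def by (simp add: infsum_nonneg)

lemma Metric_space_l2: "Metric_space l2_space l2_dist"
proof
  fix x y :: "nat \<Rightarrow> real"
  show "0 \<le> l2_dist x y"
    by (rule l2_dist_nonneg)
  show "l2_dist x y = l2_dist y x"
    by (simp add: l2_dist_def power2_commute)
next
  fix x y assume xy: "x \<in> l2_space" "y \<in> l2_space"
  have "x k = y k" if "l2_dist x y = 0" for k
    using L2_set_le_l2_dist[OF xy, of "{k}"] that by (simp add: L2_set_def)
  then show "l2_dist x y = 0 \<longleftrightarrow> x = y"
    by (auto simp: l2_dist_def)
next
  fix x y z assume xyz: "x \<in> l2_space" "y \<in> l2_space" "z \<in> l2_space"
  let ?D = "l2_dist x y + l2_dist y z"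
  have "(\<Sum>\<^sub>\<infinity>k. (x k - z k)\<^sup>2) \<le> ?D\<^sup>2"
  proof (rule infsum_le_finite_sums)
    show "(\<lambda>k. (x k - z k)\<^sup>2) summable_on UNIV"
      using xyz by (rule_tac l2_space_diff_summable)
    fix F :: "nat set" assume F: "finite F"
    have "L2_set (\<lambda>k. x k - z k) F = L2_set (\<lambda>k. (x k - y k) + (y k - z k)) F"
      by simp
    also have "\<dots> \<le> L2_set (\<lambda>k. x k - y k) F + L2_set (\<lambda>k. y k - z k) F"
      by (rule L2_set_triangle_ineq)
    also have "\<dots> \<le> ?D"
      using xyz F by (intro add_mono L2_set_le_l2_dist)
    finally show "(\<Sum>k\<in>F. (x k - z k)\<^sup>2) \<le> ?D\<^sup>2"
      unfolding L2_set_def by (rule sqrt_le_D)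
  qed
  then show "l2_dist x z \<le> ?D"
    unfolding l2_dist_def[of x z] by (rule real_le_lsqrt[rotated 1]) (simp add: l2_dist_nonneg)
qed

definition l2_basis :: "nat \<Rightarrow> nat \<Rightarrow> real" where
  "l2_basis n = (\<lambda>k. if k = n then 1 else 0)"

definition needle :: "nat \<Rightarrow> (nat \<Rightarrow> real) set" where
  "needle n = (\<lambda>t k. t * l2_basis n k) ` {0..1}"

definition hedgehog :: "(nat \<Rightarrow> real) set" where
  "hedgehog = (\<Union>n. needle n)"

definition induces_needle_topologies :: "(nat \<Rightarrow> real) topology \<Rightarrow> bool" where
  "induces_needle_topologies T \<longleftrightarrow> topspace T = hedgehog \<and>
     (\<forall>n. subtopology T (needle n) = subtopology l2_topology (needle n))"

definition fu_hedgehog :: "(nat \<Rightarrow> real) topology" where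
  "fu_hedgehog = (THE T. induces_needle_topologies T \<and>
     (\<forall>T'. induces_needle_topologies T' \<longrightarrow> (\<forall>U. openin T' U \<longrightarrow> openin T U)))"

lemma needle_subset_l2: "needle n \<subseteq> l2_space"
proof
  fix x assume "x \<in> needle n"
  then obtain t where x: "x = (\<lambda>k. t * l2_basis n k)"
    by (auto simp: needle_def)
  have "(\<lambda>k. (x k)\<^sup>2) summable_on UNIV \<longleftrightarrow> (\<lambda>k. (x k)\<^sup>2) summable_on {n}"
    by (rule summable_on_cong_neutral) (auto simp: x l2_basis_def)
  then show "x \<in> l2_space"
    by (simp add: l2_space_def)
qed

lemma topspace_l2_topology: "topspace l2_topology = l2_space"
  unfolding l2_topology_def by (rule Metric_space.topspace_mtopology[OF Metric_space_l2])

text \<open>The strongest topology in the definition of \<^const>\<open>fu_hedgehog\<close> exists and is unique.\<close>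

lemma
  shows induces_needle_topologies_fu_hedgehog: "induces_needle_topologies fu_hedgehog"
    and fu_hedgehog_strongest:
      "induces_needle_topologies T' \<Longrightarrow> openin T' U \<Longrightarrow> openin fu_hedgehog U"
    and openin_fu_hedgehog: "openin fu_hedgehog U \<longleftrightarrow>
      U \<subseteq> hedgehog \<and> (\<forall>n. openin (subtopology l2_topology (needle n)) (U \<inter> needle n))"
proof -
  define L where "L = (\<lambda>U. U \<subseteq> hedgehog \<and>
    (\<forall>n. openin (subtopology l2_topology (needle n)) (U \<inter> needle n)))"
  define T where "T = topology L"
  have "istopology L"
    unfolding istopology_def
  proof (intro conjI allI impI)
    fix A B assume "L A" "L B"
    moreover have "A \<inter> B \<inter> needle n = (A \<inter> needle n) \<inter> (B \<inter> needle n)" for n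
      by blast
    ultimately show "L (A \<inter> B)"
      unfolding L_def by (metis inf.coboundedI1 openin_Int)
  next
    fix \<K> assume K: "\<forall>K\<in>\<K>. L K"
    have "\<Union>\<K> \<inter> needle n = (\<Union>K\<in>\<K>. K \<inter> needle n)" for n
      by blast
    moreover have "openin (subtopology l2_topology (needle n)) (\<Union>K\<in>\<K>. K \<inter> needle n)" for n
      using K by (intro openin_Union) (auto simp: L_def)
    ultimately show "L (\<Union>\<K>)"
      using K unfolding L_def by auto
  qed
  then have T: "openin T U \<longleftrightarrow> L U" for U
    by (simp add: T_def)
  have l2_open: "L (W \<inter> hedgehog)" if "openin l2_topology W" for W
  proof -
    have "W \<inter> hedgehog \<inter> needle n = W \<inter> needle n" for n
      by (auto simp: hedgehog_def)
    with that show ?thesis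
      by (auto simp: L_def openin_subtopology)
  qed
  have "hedgehog \<subseteq> l2_space"
    using needle_subset_l2 by (auto simp: hedgehog_def)
  then have "L hedgehog"
    using l2_open[OF openin_topspace] by (simp add: topspace_l2_topology inf_absorb2)
  then have top: "topspace T = hedgehog"
    by (auto simp: topspace_def T) (auto simp: L_def)
  have sub: "subtopology T (needle n) = subtopology l2_topology (needle n)" for n
    unfolding topology_eq
  proof (intro allI iffI)
    fix S assume "openin (subtopology T (needle n)) S"
    then show "openin (subtopology l2_topology (needle n)) S"
      unfolding openin_subtopology[of T] by (auto simp: T L_def)
  next
    fix S assume "openin (subtopology l2_topology (needle n)) S"
    then obtain W where W: "openin l2_topology W" "S = W \<inter> needle n"
      by (auto simp: openin_subtopology)
    then have "S = W \<inter> hedgehog \<inter> needle n"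
      by (auto simp: hedgehog_def)
    then show "openin (subtopology T (needle n)) S"
      using l2_open[OF W(1)] T by (auto simp: openin_subtopology)
  qed
  have ind: "induces_needle_topologies T"
    using top sub by (simp add: induces_needle_topologies_def)
  have strongest: "openin T U" if "induces_needle_topologies T'" "openin T' U" for T' U
    unfolding T L_def
  proof (intro conjI allI)
    show "U \<subseteq> hedgehog"
      using that openin_subset by (auto simp: induces_needle_topologies_def)
    show "openin (subtopology l2_topology (needle n)) (U \<inter> needle n)" for n
      using that by (metis induces_needle_topologies_def openin_subtopology)
  qed
  have eq: "fu_hedgehog = T"
    unfolding fu_hedgehog_def
  proof (rule the_equality)
    fix T1 assume "induces_needle_topologies T1 \<and>
      (\<forall>T'. induces_needle_topologies T' \<longrightarrow> (\<forall>U. openin T' U \<longrightarrow> openin T1 U))"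
    then show "T1 = T"
      unfolding topology_eq using ind strongest by blast
  qed (use ind strongest in blast)
  show "induces_needle_topologies fu_hedgehog"
    using ind by (simp add: eq)
  show "induces_needle_topologies T' \<Longrightarrow> openin T' U \<Longrightarrow> openin fu_hedgehog U"
    using strongest by (simp add: eq)
  show "openin fu_hedgehog U \<longleftrightarrow>
      U \<subseteq> hedgehog \<and> (\<forall>n. openin (subtopology l2_topology (needle n)) (U \<inter> needle n))"
    by (simp add: eq T L_def)
qed

end

theory Submission
  imports Defs
begin

text \<open>
  A continuous map \<open>f\<close> from a cube whose images of any two opposite faces among the first \<open>n\<close>
  directions are disjoint has an image of dimension at least \<open>n\<close>, by Lebesgue's covering theorem
  (no injectivity is needed).
  Such maps into the group are built one direction at a time. Let \<open>\<gamma>\<^sub>m\<close> be the \<open>m\<close>-th needle,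
  translated to start at \<open>0\<close>, and let \<open>K\<close> be the image of \<open>f\<close>. The map
  \<open>x \<mapsto> f x + \<gamma>\<^sub>m (\<delta> x\<^sub>n)\<close> separates the faces in the new direction as soon as
  \<open>\<gamma>\<^sub>m \<delta> \<notin> -K + K\<close>, and it still separates the old ones if \<open>\<delta>\<close> is small. If no such \<open>m\<close>
  and \<open>\<delta>\<close> existed, every needle would start inside \<open>-K + K\<close>, which is first countable, being a
  continuous image of a compact metric space; but the hedgehog is not first countable at its centre.
\<close>

section \<open>Lebesgue's covering theorem for the Hilbert cube\<close>

text \<open>One compact domain serves every \<open>n\<close>: only finitely many directions are
  tested at a time, and a fresh one is always left for the induction.\<close>

definition hilbert_cube :: "(nat \<Rightarrow> real) set" where
  "hilbert_cube = {x. \<forall>i. x i \<in> {0..1}}"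

lemma compact_hilbert_cube: "compact hilbert_cube"
proof -
  have "hilbert_cube = (\<Pi>\<^sub>E i\<in>UNIV. {0..1})"
    by (auto simp: hilbert_cube_def PiE_def Pi_def)
  moreover have "compactin (product_topology (\<lambda>i::nat. euclidean :: real topology) UNIV)
      (\<Pi>\<^sub>E i\<in>UNIV. {0..1})"
    by (simp add: compactin_PiE)
  ultimately show ?thesis
    by (simp add: euclidean_product_topology)
qed

text \<open>The product metric weights the coordinates by powers of 1/2, which sum to 2; so grid
  estimates made coordinatewise carry over to balls.\<close>

lemma dist_fun_le:
  fixes x y :: "nat \<Rightarrow> real"
  assumes "\<And>j. dist (x j) (y j) \<le> e"
  shows "dist x y \<le> 2 * e"
proof -
  have e: "0 \<le> e"
    using assms[of 0] zero_le_dist[of "x 0" "y 0"] by linarith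
  let ?g = "\<lambda>n. (1 / 2) ^ n * min (dist (x (from_nat n)) (y (from_nat n))) 1"
  have le: "?g n \<le> (1 / 2) ^ n * e" for n
    using assms[of "from_nat n"] by (intro mult_left_mono) auto
  have s: "summable (\<lambda>n. (1 / 2 :: real) ^ n * e)"
    by (intro summable_mult2 summable_geometric) auto
  have "dist x y \<le> (\<Sum>n. (1 / 2) ^ n * e)"
    unfolding dist_fun_def
  proof (rule suminf_le)
    show "summable ?g"
      by (rule summable_comparison_test'[OF s, of 0]) (use le in auto)
  qed (use le s in auto)
  also have "\<dots> = 2 * e"
    by (subst suminf_mult2[symmetric]) (auto simp: suminf_geometric)
  finally show ?thesis .
qed

lemma compact_hilbert_cube_face: "compact (hilbert_cube \<inter> {x. x i = c})"
  by (intro compact_Int_closed compact_hilbert_cube closed_Collect_eq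
      continuous_on_product_coordinates continuous_on_const)

text \<open>Sperner's lemma, in Kuhn's form, for a grid finer than the Lebesgue number of the cover: each
  grid point \<open>x\<close> picks a member \<open>pick x\<close> of the cover containing a ball about it, and its label in
  direction \<open>j\<close> records whether this member meets the face \<open>x\<^sub>j = 1\<close>. The vertices of a small
  simplex carrying all \<open>n + 1\<close> reduced labels pick different members, all containing the simplex.\<close>

lemma hilbert_cube_covering:
  assumes op: "\<And>i. i \<in> I \<Longrightarrow> openin (top_of_set hilbert_cube) (U i)"
    and cover: "hilbert_cube \<subseteq> (\<Union>i\<in>I. U i)"
    and faces: "\<And>i j x y. \<lbrakk>i \<in> I; j < n; x \<in> U i; y \<in> U i; x j = 0; y j = 1\<rbrakk> \<Longrightarrow> False"
  obtains z J where "z \<in> hilbert_cube" "J \<subseteq> I" "card J = Suc n" "\<And>i. i \<in> J \<Longrightarrow> z \<in> U i"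
proof -
  have "\<exists>W. open W \<and> U i = hilbert_cube \<inter> W" if "i \<in> I" for i
    using op[OF that] by (auto simp: openin_open)
  then obtain W where W: "\<And>i. i \<in> I \<Longrightarrow> open (W i)" "\<And>i. i \<in> I \<Longrightarrow> U i = hilbert_cube \<inter> W i"
    by metis
  have "hilbert_cube \<subseteq> \<Union>(W ` I)"
    using cover W(2) by blast
  then obtain e where e: "e > 0" "\<And>x. x \<in> hilbert_cube \<Longrightarrow> \<exists>G\<in>W ` I. ball x e \<subseteq> G"
    using Heine_Borel_lemma[OF compact_hilbert_cube, of "W ` I"] W(1) by (metis imageE)
  \<comment> \<open>Vertices of one simplex will differ by at most \<open>1 / p\<close> per
    coordinate, hence by at most \<open>2 / p\<close> in distance, which must stay below
    \<open>e\<close>.\<close>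
  obtain p :: nat where p: "2 / e < real p"
    using reals_Archimedean2 by blast
  with e have p0: "0 < p"
    by (metis divide_pos_pos less_trans of_nat_0_less_iff zero_less_numeral)
  have small: "2 * (1 / real p) < e"
    using p p0 e by (simp add: field_simps)
  define g :: "(nat \<Rightarrow> nat) \<Rightarrow> nat \<Rightarrow> real" where "g = (\<lambda>x j. real (x j) / real p)"
  have g: "g x \<in> hilbert_cube" if "\<forall>j. x j \<le> p" for x
    using that p0 by (auto simp: hilbert_cube_def g_def divide_le_eq_1)
  define pick where "pick x = (SOME i. i \<in> I \<and> ball (g x) e \<subseteq> W i)" for x
  have pick: "pick x \<in> I" "ball (g x) e \<subseteq> W (pick x)" if "\<forall>j. x j \<le> p" for x
  proof -
    have "\<exists>i. i \<in> I \<and> ball (g x) e \<subseteq> W i"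
      using e(2)[OF g[OF that]] by auto
    from someI_ex[OF this] show "pick x \<in> I" "ball (g x) e \<subseteq> W (pick x)"
      unfolding pick_def by auto
  qed
  have gU: "g x \<in> U (pick x)" if "\<forall>j. x j \<le> p" for x
    using pick[OF that] g[OF that] W(2) e(1) by auto
  define L :: "_ \<Rightarrow> nat \<Rightarrow> nat" where "L i j = (if \<exists>y\<in>U i. y j = 1 then 1 else 0)" for i j
  have "odd (card {s. ksimplex p n s \<and> (reduced n \<circ> (L \<circ> pick)) ` s = {..n}})"
  proof (rule kuhn_combinatorial[OF p0]; intro allI impI)
    fix x :: "nat \<Rightarrow> nat" and j
    assume A: "(\<forall>j. x j \<le> p) \<and> j < n \<and> x j = 0"
    then have "g x j = 0"
      by (simp add: g_def)
    \<comment> \<open>The picked member contains a point of the face 0, so by \<open>faces\<close>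
      it misses the face 1.\<close>
    with A show "(L \<circ> pick) x j = 0"
      using faces[OF pick(1) _ gU] by (auto simp: L_def)
  next
    fix x :: "nat \<Rightarrow> nat" and j
    assume A: "(\<forall>j. x j \<le> p) \<and> j < n \<and> x j = p"
    then have "g x j = 1"
      using p0 by (simp add: g_def)
    with A show "(L \<circ> pick) x j = 1"
      using gU by (auto simp: L_def)
  qed
  then have "{s. ksimplex p n s \<and> (reduced n \<circ> (L \<circ> pick)) ` s = {..n}} \<noteq> {}"
    by (rule odd_card_imp_not_empty)
  then obtain s b u where "kuhn_simplex p n b u s"
    and rl: "(reduced n \<circ> (L \<circ> pick)) ` s = {..n}" and ks: "ksimplex p n s"
    by (metis (mono_tags, lifting) Collect_empty_eq ksimplex.cases)
  interpret kuhn_simplex p n b u s by fact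
  \<comment> \<open>Kuhn simplices have all coordinates from index \<open>n\<close> on equal to
    \<open>p\<close>, so their vertices also belong to the infinite grid.\<close>
  have bound: "\<forall>j. x j \<le> p" if "x \<in> s" for x
    using s_space out_eq_p[OF that] that by (metis PiE atMost_iff lessThan_iff not_le order_refl subsetD)
  have card_s: "card s = Suc n"
    using ks by (rule ksimplex_card)
  then have fin: "finite s"
    by (metis card.infinite nat.distinct(1))
  from card_s obtain v where v: "v \<in> s"
    by (metis card.empty ex_in_conv nat.distinct(1))
  show thesis
  proof (rule that)
    show "g v \<in> hilbert_cube"
      using g bound v by blast
    show "pick ` s \<subseteq> I"
      using pick(1) bound by blast
    show "card (pick ` s) = Suc n"
    proof (rule antisym)
      show "card (pick ` s) \<le> Suc n"
        using card_image_le[OF fin, of pick] card_s by simp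
      have "(reduced n \<circ> L) ` (pick ` s) = {..n}"
        using rl by (simp add: image_comp comp_assoc)
      then show "Suc n \<le> card (pick ` s)"
        using card_image_le[of "pick ` s" "reduced n \<circ> L"] fin by simp
    qed
    fix i assume "i \<in> pick ` s"
    then obtain x where x: "x \<in> s" "i = pick x"
      by blast
    have "dist (g x j) (g v j) \<le> 1 / real p" for j
    proof -
      have "\<bar>real (x j) - real (v j)\<bar> \<le> 1"
        using x(1) v by (auto simp: s_eq enum_def)
      then show ?thesis
        by (simp add: g_def dist_real_def divide_right_mono flip: diff_divide_distrib)
    qed
    then have "dist (g x) (g v) < e"
      using dist_fun_le[of "g x" "g v"] small by force
    then show "g v \<in> U i"
      using pick[OF bound[OF x(1)]] g[OF bound[OF v]] W(2) x(2) by auto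
  qed
qed

text \<open>For each \<open>i < n\<close>, discard from the image one of the two disjoint closed
  images of opposite faces; all such choices give a finite open cover. Pulled back to the cube, a
  refinement has no member meeting two opposite faces, so some point lies in \<open>Suc n\<close>
  members.\<close>

lemma covering_dim_le_hilbert_cube_image:
  fixes f :: "(nat \<Rightarrow> real) \<Rightarrow> 'a::t2_space"
  assumes cont: "continuous_on hilbert_cube f"
    and faces: "\<And>i x y. \<lbrakk>i < n; x \<in> hilbert_cube; y \<in> hilbert_cube; x i = 0; y i = 1\<rbrakk> \<Longrightarrow> f x \<noteq> f y"
    and dim: "covering_dim_le (top_of_set (f ` hilbert_cube)) k"
  shows "int n \<le> k"
proof -
  let ?K = "f ` hilbert_cube"
  define face where "face i c = f ` (hilbert_cube \<inter> {x. x i = c})" for i and c :: real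
  have clo: "closed (face i c)" for i c
    unfolding face_def using cont compact_hilbert_cube_face
    by (meson compact_continuous_image compact_imp_closed continuous_on_subset inf_le1)
  define U where "U s = ?K - (\<Union>i<n. face i (if i \<in> s then 0 else 1))" for s
  have U_open: "openin (top_of_set ?K) (U s)" for s
  proof -
    have "closed (\<Union>i<n. face i (if i \<in> s then 0 else 1))"
      using clo by (intro closed_UN) auto
    then show ?thesis
      unfolding U_def Diff_eq by (intro openin_open_Int open_Compl)
  qed
  have "?K \<subseteq> \<Union>(U ` Pow {..<n})"
  proof (rule subsetI)
    fix x assume x: "x \<in> ?K"
    have "x \<notin> face i 0" if "i < n" "x \<in> face i 1" for i
      using faces that unfolding face_def by fastforce
    \<comment> \<open>Where \<open>x\<close> lies on the image of the face 1 the face 0 is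
      discarded, and in all other directions the face 1.\<close>
    with x have "x \<in> U ({..<n} \<inter> {i. x \<in> face i 1})"
      by (auto simp: U_def)
    then show "x \<in> \<Union>(U ` Pow {..<n})"
      by (rule UN_I[rotated]) simp
  qed
  moreover have "\<Union>(U ` Pow {..<n}) \<subseteq> ?K"
    unfolding U_def by blast
  ultimately have U_cover: "\<Union>(U ` Pow {..<n}) = topspace (top_of_set ?K)"
    unfolding topspace_euclidean_subtopology by (rule equalityI[rotated])
  have "\<exists>\<V>. finite \<V> \<and> (\<forall>V\<in>\<V>. openin (top_of_set ?K) V) \<and>
      \<Union>\<V> = topspace (top_of_set ?K) \<and> (\<forall>V\<in>\<V>. \<exists>W\<in>U ` Pow {..<n}. V \<subseteq> W) \<and>
      (\<forall>x\<in>topspace (top_of_set ?K). int (card {V\<in>\<V>. x \<in> V}) \<le> k + 1)"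
  proof (rule dim[unfolded covering_dim_le_def, THEN conjunct2, THEN spec, THEN mp], intro conjI ballI)
    show "\<Union>(U ` Pow {..<n}) = topspace (top_of_set ?K)"
      by (rule U_cover)
  qed (use U_open in auto)
  then obtain \<V> where V: "finite \<V>" "\<forall>V\<in>\<V>. openin (top_of_set ?K) V" "\<Union>\<V> = ?K"
      "\<forall>V\<in>\<V>. \<exists>W\<in>U ` Pow {..<n}. V \<subseteq> W"
    and card: "\<forall>x\<in>?K. int (card {V\<in>\<V>. x \<in> V}) \<le> k + 1"
    unfolding topspace_euclidean_subtopology by (elim exE conjE)
  \<comment> \<open>The pulled-back cover is indexed by \<V> itself, so \<open>J\<close> consists of
    distinct members of the refinement.\<close>
  obtain z J where z: "z \<in> hilbert_cube" "J \<subseteq> \<V>" "card J = Suc n"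
    "\<And>V. V \<in> J \<Longrightarrow> z \<in> hilbert_cube \<inter> f -` V"
  proof (rule hilbert_cube_covering[of \<V> "\<lambda>V. hilbert_cube \<inter> f -` V" n])
    show "openin (top_of_set hilbert_cube) (hilbert_cube \<inter> f -` V)" if "V \<in> \<V>" for V
      using V(2) that cont unfolding continuous_on_open by blast
    show "hilbert_cube \<subseteq> (\<Union>V\<in>\<V>. hilbert_cube \<inter> f -` V)"
    proof (rule subsetI)
      fix x assume x: "x \<in> hilbert_cube"
      then have "f x \<in> \<Union>\<V>"
        unfolding V(3) by (rule imageI)
      then show "x \<in> (\<Union>V\<in>\<V>. hilbert_cube \<inter> f -` V)"
        using x by auto
    qed
    fix V j x y
    assume A: "V \<in> \<V>" "j < n" "x \<in> hilbert_cube \<inter> f -` V" "y \<in> hilbert_cube \<inter> f -` V"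
      "x j = 0" "y j = 1"
    then obtain s where "V \<subseteq> U s"
      using V(4) by blast
    then have "f x \<in> U s" "f y \<in> U s"
      using A by auto
    then have "f x \<notin> face j (if j \<in> s then 0 else 1)" "f y \<notin> face j (if j \<in> s then 0 else 1)"
      using A(2) unfolding U_def by blast+
    then show False
      using A by (cases "j \<in> s") (auto simp: face_def)
  qed blast
  have "J \<subseteq> {V\<in>\<V>. f z \<in> V}"
    using z(2,4) by auto
  then have "Suc n \<le> card {V\<in>\<V>. f z \<in> V}"
    using card_mono[of "{V\<in>\<V>. f z \<in> V}" J] V(1) z(3) by simp
  moreover have "int (card {V\<in>\<V>. f z \<in> V}) \<le> k + 1"
    using card z(1) by (rule bspec[OF _ imageI])
  ultimately show ?thesis
    by fastforce
qed

section \<open>Needles leaving a metrizable compact set\<close>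

text \<open>The last assumption on \<open>\<gamma>\<close> says that the needles span a fan that is not first countable
  at \<open>0\<close>.\<close>

lemma exists_needle_leaving_compact:
  fixes \<gamma> :: "nat \<Rightarrow> real \<Rightarrow> 'a::{t2_space,zero}" and h :: "'b::metric_space \<Rightarrow> 'a"
  assumes C: "compact C" and h: "continuous_on C h" and "0 \<in> h ` C"
    and \<gamma>: "\<And>m. continuous_on {0..1} (\<gamma> m)" "\<And>m. \<gamma> m 0 = 0"
    and fan: "\<forall>t. (\<forall>m. t m \<in> {0<..1}) \<longrightarrow> (\<exists>W. open W \<and> 0 \<in> W \<and> (\<forall>m. \<gamma> m (t m) \<notin> W))"
  shows "\<exists>m. \<forall>e>0. \<exists>t\<in>{0<..1}. t < e \<and> \<gamma> m t \<notin> h ` C"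
proof (rule ccontr)
  assume "\<not> ?thesis"
  then obtain e where e: "\<And>m. e m > 0" "\<And>m t. \<lbrakk>t \<in> {0<..1}; t < e m\<rbrakk> \<Longrightarrow> \<gamma> m t \<in> h ` C"
    by metis
  \<comment> \<open>As \<open>h\<close> need not be injective, closeness to 0 is measured in
    \<open>C\<close> by the distance to the whole fibre over 0.\<close>
  define Z where "Z = {c \<in> C. h c = 0}"
  have "Z \<noteq> {}"
    using \<open>0 \<in> h ` C\<close> by (auto simp: Z_def)
  have "closed Z"
    using continuous_closed_preimage[OF h compact_imp_closed[OF C], of "{0}"]
    by (simp add: Z_def vimage_def Int_def)
  \<comment> \<open>The image of \<open>far m\<close> is compact and misses 0, so needle
    \<open>m\<close> avoids it near its start: there, preimages in \<open>C\<close> are within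
    \<open>1 / Suc m\<close> of \<open>Z\<close>.\<close>
  define far where "far m = C \<inter> {c. 1 / real (Suc m) \<le> infdist c Z}" for m
  have far_image: "closed (h ` far m)" "0 \<notin> h ` far m" for m
  proof -
    have "closed {c. 1 / real (Suc m) \<le> infdist c Z}"
      by (intro closed_Collect_le continuous_intros)
    then have "compact (far m)"
      unfolding far_def using C by (rule compact_Int_closed[rotated])
    then show "closed (h ` far m)"
      unfolding far_def using h
      by (meson compact_continuous_image compact_imp_closed continuous_on_subset inf_le1)
    show "0 \<notin> h ` far m"
    proof
      assume "0 \<in> h ` far m"
      then obtain c where "c \<in> Z" "1 / real (Suc m) \<le> infdist c Z"
        by (auto simp: Z_def far_def)
      then show False
        by simp
    qed
  qed
  have "\<exists>t c. t \<in> {0<..1} \<and> c \<in> C \<and> h c = \<gamma> m t \<and> infdist c Z < 1 / real (Suc m)" for m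
  proof -
    have "(\<gamma> m \<longlongrightarrow> 0) (at 0 within {0..1})"
      using \<gamma>[of m] by (metis atLeastAtMost_iff continuous_on_def order_refl zero_le_one)
    moreover have "open (- h ` far m)" "0 \<in> - h ` far m"
      using far_image by auto
    ultimately have "\<forall>\<^sub>F t in at 0 within {0..1}. \<gamma> m t \<in> - h ` far m"
      by (rule topological_tendstoD)
    then obtain d where d: "d > 0" "\<And>t. \<lbrakk>t \<in> {0..1}; t \<noteq> 0; dist t 0 < d\<rbrakk> \<Longrightarrow> \<gamma> m t \<notin> h ` far m"
      unfolding eventually_at by auto
    define t where "t = min 1 (min d (e m) / 2)"
    have t: "t \<in> {0<..1}" "t < d" "t < e m"
      using d(1) e(1)[of m] by (auto simp: t_def min_def)
    then obtain c where "c \<in> C" "h c = \<gamma> m t"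
      using e(2) by (metis imageE)
    moreover have "\<gamma> m t \<notin> h ` far m"
      using d(2)[of t] t by (auto simp: dist_real_def)
    then have "c \<notin> far m"
      using \<open>h c = \<gamma> m t\<close> by (metis imageI)
    ultimately show ?thesis
      using t(1) by (auto simp: far_def not_le)
  qed
  then obtain t c where tc: "\<And>m. t m \<in> {0<..1}" "\<And>m. c m \<in> C" "\<And>m. h (c m) = \<gamma> m (t m)"
      "\<And>m. infdist (c m) Z < 1 / real (Suc m)"
    by metis
  \<comment> \<open>\<open>W\<close> avoids all chosen needle points, yet a subsequence of their
    preimages converges into \<open>Z\<close>, which forces these points to tend to 0.\<close>
  obtain W where W: "open W" "0 \<in> W" "\<And>m. \<gamma> m (t m) \<notin> W"
    using fan tc(1) by blast
  obtain l r where lr: "l \<in> C" "strict_mono r" "(c \<circ> r) \<longlonglongrightarrow> l"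
    using C tc(2) unfolding compact_def by blast
  have "(\<lambda>k. infdist ((c \<circ> r) k) Z) \<longlonglongrightarrow> infdist l Z"
    using lr(3) by (rule tendsto_infdist)
  moreover have "(\<lambda>k. infdist ((c \<circ> r) k) Z) \<longlonglongrightarrow> 0"
  proof (rule tendsto_sandwich[OF _ _ tendsto_const])
    show "((\<lambda>m. 1 / real (Suc m)) \<circ> r) \<longlonglongrightarrow> 0"
      by (intro LIMSEQ_subseq_LIMSEQ lr(2) LIMSEQ_Suc lim_1_over_n)
    show "\<forall>\<^sub>F k in sequentially. infdist ((c \<circ> r) k) Z \<le> ((\<lambda>m. 1 / real (Suc m)) \<circ> r) k"
      using tc(4) by (auto intro!: always_eventually less_imp_le)
  qed (auto simp: infdist_nonneg)
  ultimately have "infdist l Z = 0"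
    using LIMSEQ_unique by blast
  then have "l \<in> Z"
    using in_closed_iff_infdist_zero[OF \<open>closed Z\<close> \<open>Z \<noteq> {}\<close>] by metis
  then have "h l = 0"
    by (simp add: Z_def)
  moreover have "(\<lambda>k. h ((c \<circ> r) k)) \<longlonglongrightarrow> h l"
    by (rule continuous_on_tendsto_compose[OF h lr(3,1)]) (auto simp: tc(2))
  ultimately have "\<forall>\<^sub>F k in sequentially. h ((c \<circ> r) k) \<in> W"
    using W(1,2) by (metis topological_tendstoD)
  then show False
    using tc(3) W(3) by (auto simp: eventually_sequentially)
qed

section \<open>Cubes in groups containing the hedgehog\<close>

lemma exists_cube_separating_faces:
  fixes \<gamma> :: "nat \<Rightarrow> real \<Rightarrow> 'a::{topological_group_add, t2_space}"
  assumes \<gamma>: "\<And>m. continuous_on {0..1} (\<gamma> m)" "\<And>m. \<gamma> m 0 = 0"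
    and fan: "\<forall>t. (\<forall>m. t m \<in> {0<..1}) \<longrightarrow> (\<exists>W. open W \<and> 0 \<in> W \<and> (\<forall>m. \<gamma> m (t m) \<notin> W))"
  shows "\<exists>f :: (nat \<Rightarrow> real) \<Rightarrow> 'a. continuous_on hilbert_cube f \<and>
    (\<forall>i<n. \<forall>x\<in>hilbert_cube. \<forall>y\<in>hilbert_cube. x i = 0 \<and> y i = 1 \<longrightarrow> f x \<noteq> f y)"
proof (induction n)
  case 0
  show ?case
    by (rule exI[of _ "\<lambda>_. 0"]) auto
next
  case (Suc n)
  let ?C = "hilbert_cube"
  obtain f :: "(nat \<Rightarrow> real) \<Rightarrow> 'a" where f: "continuous_on ?C f"
    and faces: "\<And>i x y. \<lbrakk>i < n; x \<in> ?C; y \<in> ?C; x i = 0; y i = 1\<rbrakk> \<Longrightarrow> f x \<noteq> f y"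
    using Suc by blast
  \<comment> \<open>The group need not be commutative: the needle will be added on the right, so
    \<open>f x\<close> is cancelled from the left.\<close>
  define h where "h = (\<lambda>(x, y). - f x + f y)"
  have h: "continuous_on (?C \<times> ?C) h"
    unfolding h_def case_prod_unfold
    by (intro continuous_intros continuous_on_compose2[OF f]) auto
  have CC: "compact (?C \<times> ?C)"
    by (intro compact_Times compact_hilbert_cube)
  have h0: "0 \<in> h ` (?C \<times> ?C)"
    by (rule image_eqI[of _ _ "(\<lambda>_. 0, \<lambda>_. 0)"]) (auto simp: h_def hilbert_cube_def)
  obtain m where m: "\<And>e. e > 0 \<Longrightarrow> \<exists>t\<in>{0<..1}. t < e \<and> \<gamma> m t \<notin> h ` (?C \<times> ?C)"
    using exists_needle_leaving_compact[OF CC h h0 \<gamma> fan] by blast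
  \<comment> \<open>The differences across old pairs of faces form a closed set missing 0;
    perturbations whose differences avoid it keep these faces apart.\<close>
  define D where "D = (\<Union>i<n. h ` ((?C \<inter> {x. x i = 0}) \<times> (?C \<inter> {y. y i = 1})))"
  have "compact ((?C \<inter> {x. x i = 0}) \<times> (?C \<inter> {y. y i = 1}))" for i
    by (intro compact_Times compact_hilbert_cube_face)
  then have "closed (h ` ((?C \<inter> {x. x i = 0}) \<times> (?C \<inter> {y. y i = 1})))" for i
    by (intro compact_imp_closed compact_continuous_image continuous_on_subset[OF h]) auto
  then have "closed D"
    unfolding D_def by (intro closed_UN) auto
  have "0 \<notin> D"
  proof
    assume "0 \<in> D"
    then obtain i x y where "i < n" "x \<in> ?C" "y \<in> ?C" "x i = 0" "y i = 1" "- f x + f y = 0"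
      unfolding D_def h_def by auto
    then show False
      using faces by (metis add.inverse_inverse minus_unique)
  qed
  define \<beta> where "\<beta> = (\<lambda>(s, t). \<gamma> m s - \<gamma> m t)"
  have "continuous_on ({0..1} \<times> {0..1}) \<beta>"
    unfolding \<beta>_def case_prod_unfold
    by (intro continuous_intros continuous_on_compose2[OF \<gamma>(1)]) auto
  then have "(\<beta> \<longlongrightarrow> \<beta> (0, 0)) (at (0, 0) within {0..1} \<times> {0..1})"
    by (auto simp: continuous_on_def)
  moreover have "\<beta> (0, 0) \<in> - D" "open (- D)"
    using \<open>0 \<notin> D\<close> \<open>closed D\<close> by (auto simp: \<beta>_def \<gamma>(2))
  ultimately have "\<forall>\<^sub>F q in at (0, 0) within {0..1} \<times> {0..1}. \<beta> q \<in> - D"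
    using topological_tendstoD by blast
  then obtain e where e: "e > 0"
    "\<And>q. \<lbrakk>q \<in> {0..1} \<times> {0..1}; q \<noteq> (0, 0); dist q (0, 0) < e\<rbrakk> \<Longrightarrow> \<beta> q \<notin> D"
    unfolding eventually_at by auto
  \<comment> \<open>The punctured limit says nothing at \<open>(0, 0)\<close>, hence the case split;
    \<open>e / 2\<close> is used because the distance in the plane is at most the sum of the
    coordinates.\<close>
  have \<beta>: "\<gamma> m s - \<gamma> m t \<notin> D" if "s \<in> {0..1}" "t \<in> {0..1}" "s < e / 2" "t < e / 2" for s t
  proof (cases "(s, t) = (0, 0)")
    case True
    then show ?thesis
      using \<open>0 \<notin> D\<close> by simp
  next
    case False
    have "dist (s, t) (0, 0) \<le> dist s 0 + dist t 0"
      unfolding dist_Pair_Pair by (rule sqrt_sum_squares_le_sum) auto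
    also have "\<dots> < e"
      using that by (auto simp: dist_real_def)
    finally show ?thesis
      using e(2)[of "(s, t)"] that False by (auto simp: \<beta>_def)
  qed
  \<comment> \<open>Smallness of \<open>d\<close> preserves the old separations; leaving the image
    of \<open>h\<close> gives the new one.\<close>
  obtain d where d: "d \<in> {0<..1}" "d < e / 2" "\<gamma> m d \<notin> h ` (?C \<times> ?C)"
    using m[of "e / 2"] e(1) by auto
  have unit: "d * x i \<in> {0..1}" "d * x i < e / 2" if "x \<in> ?C" for x i
  proof -
    have "0 \<le> x i" "x i \<le> 1"
      using that by (auto simp: hilbert_cube_def)
    then have "0 \<le> d * x i" "d * x i \<le> d"
      using d(1) by (auto simp: mult_left_le)
    moreover have "d \<le> 1"
      using d(1) by simp
    ultimately show "d * x i \<in> {0..1}"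
      unfolding atLeastAtMost_iff by linarith
    show "d * x i < e / 2"
      using \<open>d * x i \<le> d\<close> d(2) by linarith
  qed
  define f' where "f' x = f x + \<gamma> m (d * x n)" for x
  have "continuous_on ?C f'"
    unfolding f'_def using unit
    by (intro continuous_intros f continuous_on_compose2[OF \<gamma>(1)]
        continuous_on_subset[OF continuous_on_product_coordinates]) auto
  moreover have "f' x \<noteq> f' y" if A: "i < Suc n" "x \<in> ?C" "y \<in> ?C" "x i = 0" "y i = 1" for i x y
  proof
    assume "f' x = f' y"
    then have "- f x + (f x + \<gamma> m (d * x n)) = - f x + (f y + \<gamma> m (d * y n))"
      by (simp add: f'_def)
    then have eq: "\<gamma> m (d * x n) = h (x, y) + \<gamma> m (d * y n)"
      by (simp add: h_def add.assoc)
    show False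
    proof (cases "i = n")
      case True
      \<comment> \<open>Here \<open>x n = 0\<close> and \<open>y n = 1\<close>, so only the needle
        term of \<open>y\<close> survives.\<close>
      with A have "f x = f y + \<gamma> m d"
        using \<open>f' x = f' y\<close> by (simp add: f'_def \<gamma>(2))
      then have "\<gamma> m d = h (y, x)"
        by (simp add: h_def flip: add.assoc)
      with d(3) A show False
        by auto
    next
      case False
      have "\<gamma> m (d * x n) - \<gamma> m (d * y n) = h (x, y)"
        using eq by simp
      moreover have "h (x, y) \<in> D"
        using A False unfolding D_def by (intro UN_I[of i] imageI) auto
      ultimately show False
        using \<beta> unit A(2,3) by metis
    qed
  qed
  ultimately show ?case
    by blast
qed

section \<open>Needles of the hedgehog\<close>

lemma needle_point_in_hedgehog: "t \<in> {0..1} \<Longrightarrow> (\<lambda>k. t * l2_basis n k) \<in> hedgehog"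
  unfolding hedgehog_def needle_def by (rule UN_I[OF UNIV_I], rule imageI)

text \<open>The parametrization is an isometry into the Hilbert space, and on a single needle the
  hedgehog topology is the Euclidean one.\<close>

lemma continuous_map_fu_hedgehog_needle:
  "continuous_map (top_of_set {0..1 :: real}) fu_hedgehog (\<lambda>t k. t * l2_basis n k)"
proof -
  let ?p = "\<lambda>(t :: real) k. t * l2_basis n k"
  have dist: "l2_dist (?p s) (?p t) = \<bar>s - t\<bar>" for s t
  proof -
    have "(\<Sum>\<^sub>\<infinity>k. (?p s k - ?p t k)\<^sup>2) = (\<Sum>\<^sub>\<infinity>k\<in>{n}. (?p s k - ?p t k)\<^sup>2)"
      by (rule infsum_cong_neutral) (auto simp: l2_basis_def)
    then show ?thesis
      by (simp add: l2_dist_def l2_basis_def)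
  qed
  have in_needle: "?p t \<in> needle n" if "t \<in> {0..1}" for t
    using that by (auto simp: needle_def)
  interpret l2: Metric_space l2_space l2_dist
    by (rule Metric_space_l2)
  have "continuous_map (top_of_set {0..1}) l2_topology ?p"
    unfolding l2_topology_def l2.continuous_map_to_metric
  proof (intro ballI allI impI)
    fix t e :: real assume t: "t \<in> topspace (top_of_set {0..1})" and "e > 0"
    moreover have "?p s \<in> l2.mball (?p t) e" if "s \<in> {0..1} \<inter> ball t e" for s
    proof -
      have "?p s \<in> l2_space" "?p t \<in> l2_space"
        using that t by (auto intro!: subsetD[OF needle_subset_l2] in_needle)
      with that show ?thesis
        by (simp add: l2.in_mball dist dist_real_def)
    qed
    moreover have "openin (top_of_set {0..1}) ({0..1} \<inter> ball t e)"
      by (rule openin_open_Int) simp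
    ultimately show "\<exists>U. openin (top_of_set {0..1}) U \<and> t \<in> U \<and> (\<forall>s\<in>U. ?p s \<in> l2.mball (?p t) e)"
      by (intro exI[of _ "{0..1} \<inter> ball t e"] conjI ballI) simp_all
  qed
  then have "continuous_map (top_of_set {0..1}) (subtopology l2_topology (needle n)) ?p"
    unfolding continuous_map_in_subtopology using in_needle by simp
  then have "continuous_map (top_of_set {0..1}) (subtopology fu_hedgehog (needle n)) ?p"
    using induces_needle_topologies_fu_hedgehog by (simp add: induces_needle_topologies_def)
  then show ?thesis
    by (rule continuous_map_into_fulltopology)
qed

text \<open>Openness is tested needle by needle, and each needle loses just one point. As
  \<open>t\<close> is arbitrary, a diagonal choice defeats any countable base at the centre.\<close>

lemma openin_fu_hedgehog_avoiding:
  assumes t: "\<And>n. t n \<in> {0<..1}"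
  shows "openin fu_hedgehog (hedgehog - range (\<lambda>n k. t n * l2_basis n k))"
  unfolding openin_fu_hedgehog
proof (intro conjI allI)
  fix n
  define q where "q = (\<lambda>m k. t m * l2_basis m k)"
  have disjoint: "q m \<notin> needle n" if "m \<noteq> n" for m
  proof
    assume "q m \<in> needle n"
    then obtain s where "q m = (\<lambda>k. s * l2_basis n k)"
      by (auto simp: needle_def)
    then have "q m m = s * l2_basis n m"
      by (rule fun_cong)
    with that t[of m] show False
      by (simp add: l2_basis_def q_def)
  qed
  have q_needle: "q n \<in> needle n"
    unfolding needle_def q_def using t[of n] by (intro imageI) simp
  have "needle n \<subseteq> hedgehog"
    unfolding hedgehog_def by (rule UN_upper) simp
  then have eq: "(hedgehog - range q) \<inter> needle n = (l2_space - {q n}) \<inter> needle n"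
    using needle_subset_l2[of n] disjoint by fastforce
  have "closedin l2_topology {q n}"
    using q_needle needle_subset_l2
    by (metis Hausdorff_imp_t1_space Metric_space.Hausdorff_space_mtopology Metric_space_l2
        l2_topology_def subsetD t1_space_closedin_singleton topspace_l2_topology)
  then have "openin l2_topology (l2_space - {q n})"
    by (metis openin_diff openin_topspace topspace_l2_topology)
  then show "openin (subtopology l2_topology (needle n))
      ((hedgehog - range (\<lambda>n k. t n * l2_basis n k)) \<inter> needle n)"
    unfolding q_def[symmetric] eq openin_subtopology
    by (intro exI[of _ "l2_space - {q n}"] conjI) simp_all
qed (rule Diff_subset)

theorem corollary1p5:
  assumes "compactly_finite_dimensional
             (euclidean :: 'a::{topological_group_add, t2_space} topology)"
  shows "\<not> (\<exists>S :: 'a set. subtopology euclidean S homeomorphic_space fu_hedgehog)"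
proof
  assume "\<exists>S :: 'a set. subtopology euclidean S homeomorphic_space fu_hedgehog"
  then obtain S :: "'a set" and \<psi> \<phi> where maps: "homeomorphic_maps (top_of_set S) fu_hedgehog \<psi> \<phi>"
    unfolding homeomorphic_space_def by blast
  have topspace: "topspace fu_hedgehog = hedgehog"
    using induces_needle_topologies_fu_hedgehog by (simp add: induces_needle_topologies_def)
  have \<phi>: "continuous_map fu_hedgehog (top_of_set S) \<phi>"
    and \<psi>: "continuous_map (top_of_set S) fu_hedgehog \<psi>"
    and inv: "\<And>x. x \<in> hedgehog \<Longrightarrow> \<psi> (\<phi> x) = x"
    using maps by (auto simp: homeomorphic_maps_def topspace)
  let ?p = "\<lambda>m t k. t * l2_basis m k"
  let ?o = "\<lambda>k::nat. 0::real"
  have o: "?o \<in> hedgehog"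
    using needle_point_in_hedgehog[of 0] by simp
  define \<gamma> where "\<gamma> m t = - \<phi> ?o + \<phi> (?p m t)" for m t
  have \<gamma>1: "continuous_on {0..1} (\<gamma> m)" for m
  proof -
    have "continuous_map (top_of_set {0..1}) (top_of_set S) (\<phi> \<circ> ?p m)"
      using continuous_map_compose[OF continuous_map_fu_hedgehog_needle \<phi>] .
    then have "continuous_on {0..1} (\<lambda>t. \<phi> (?p m t))"
      by (simp add: continuous_map_in_subtopology comp_def)
    then show ?thesis
      unfolding \<gamma>_def by (intro continuous_intros)
  qed
  have \<gamma>2: "\<gamma> m 0 = 0" for m
    by (simp add: \<gamma>_def)
  have fan: "\<forall>t. (\<forall>m. t m \<in> {0<..1}) \<longrightarrow> (\<exists>W. open W \<and> 0 \<in> W \<and> (\<forall>m. \<gamma> m (t m) \<notin> W))"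
  proof (intro allI impI)
    fix t :: "nat \<Rightarrow> real"
    assume "\<forall>m. t m \<in> {0<..1}"
    then have t: "t m \<in> {0<..1}" for m
      by blast
    let ?D = "range (\<lambda>m. ?p m (t m))"
    have p: "?p m (t m) \<in> hedgehog" for m
      using t[of m] by (intro needle_point_in_hedgehog) auto
    \<comment> \<open>This preimage is open only relative to \<open>S\<close>; it is extended to an
      open \<open>V\<close> of the group, whose translate is the required \<open>W\<close>.\<close>
    have "openin (top_of_set S) {x \<in> topspace (top_of_set S). \<psi> x \<in> hedgehog - ?D}"
      by (rule openin_continuous_map_preimage[OF \<psi> openin_fu_hedgehog_avoiding[OF t]])
    then obtain V where V: "open V" "{x \<in> S. \<psi> x \<in> hedgehog - ?D} = S \<inter> V"
      by (auto simp: openin_open)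
    have \<phi>S: "\<phi> x \<in> S" if "x \<in> hedgehog" for x
      using \<phi> that by (auto simp: continuous_map_in_subtopology topspace)
    have "?o \<notin> ?D"
    proof
      assume "?o \<in> ?D"
      then obtain m where "?o = ?p m (t m)"
        by blast
      then have "0 = ?p m (t m) m"
        by metis
      then show False
        using t[of m] by (simp add: l2_basis_def)
    qed
    then have "\<phi> ?o \<in> V"
      using V(2) \<phi>S[OF o] inv[OF o] o by (metis (mono_tags, lifting) DiffI IntD2 mem_Collect_eq)
    moreover have "\<phi> (?p m (t m)) \<notin> V" for m
      using V(2) \<phi>S[OF p] inv[OF p] by fastforce
    moreover have "open ((\<lambda>x. \<phi> ?o + x) -` V)"
      using V(1) by (intro open_vimage continuous_intros)
    ultimately show "\<exists>W. open W \<and> 0 \<in> W \<and> (\<forall>m. \<gamma> m (t m) \<notin> W)"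
      by (intro exI[of _ "(\<lambda>x. \<phi> ?o + x) -` V"]) (simp add: \<gamma>_def flip: add.assoc)
  qed
  let ?X = "euclidean :: 'a topology"
  have "(SUP K\<in>{K. compactin ?X K}. covering_dim (subtopology ?X K)) \<noteq> \<infinity>"
    using assms unfolding compactly_finite_dimensional_def by (rule less_imp_neq)
  \<comment> \<open>\<open>n\<close> lies strictly above the dimension of every compact subspace,
    but the cube built for this \<open>n\<close> has an image of dimension at least
    \<open>n\<close>.\<close>
  then obtain n :: nat
    where n: "(SUP K\<in>{K. compactin ?X K}. covering_dim (subtopology ?X K)) < ereal (real n)"
    unfolding less_PInf_Ex_of_nat by (elim exE)
  obtain f :: "(nat \<Rightarrow> real) \<Rightarrow> 'a" where f: "continuous_on hilbert_cube f"
    and faces: "\<And>i x y. \<lbrakk>i < n; x \<in> hilbert_cube; y \<in> hilbert_cube; x i = 0; y i = 1\<rbrakk> \<Longrightarrow> f x \<noteq> f y"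
    using exists_cube_separating_faces[OF \<gamma>1 \<gamma>2 fan, of n] by blast
  have "compact (f ` hilbert_cube)"
    using f compact_hilbert_cube by (rule compact_continuous_image)
  then have "covering_dim (top_of_set (f ` hilbert_cube)) < ereal n"
    by (intro le_less_trans[OF SUP_upper n]) simp
  then obtain k where "covering_dim_le (top_of_set (f ` hilbert_cube)) k" "real_of_int k < n"
    unfolding covering_dim_def INF_less_iff by auto
  then show False
    using covering_dim_le_hilbert_cube_image[OF f faces] by fastforce
qed

end
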